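(* Consider the channel creation game with $N>3$ nodes, blockchain fee $F_B>0$, constant forwarding fee $f_0\ge 0$, and the homogeneous payment scenario with $k\ge 1$ payments from every node to every other node. Consider the strategy combination of a star with two centers: two nodes (the centers) each open a channel to each of the $N-2$ other nodes (the outer nodes) but not to each other, and the outer nodes open no channels. If $$\frac{F_B}{k}\cdot\frac{2}{N}<f_0<\frac{F_B}{k}\cdot\frac{3}{N-1},$$ then this strategy combination is a Nash equilibrium.
   Context: Channel creation game. The players are the $N$ nodes. Fixed parameters: a blockchain fee $F_B\in\mathbb{R}$, $F_B>0$, a forwarding fee $f_0\ge 0$ that is the same for all nodes, and a payment scenario (a finite multiset of transactions, each with a sender and a different receiver). In the homogeneous payment scenario, for every ordered pair $(s,r)$ of distinct nodes there are exactly $k$ transactions from $s$ to $r$. Strategies: simultaneously and with full information, each node $u$ chooses a set $\mu_u$ of other nodes to which it opens channels; it pays $F_B$ for each channel it opens. Channels are usable in both directions by everyone and have unlimited capital. The strategy combination determines an undirected graph with an edge $\{u,v\}$ whenever $u$ opens a channel to $v$ or $v$ to $u$. Transactions: a route of a transaction is a path in this graph from sender to receiver; a route with $\ell$ edges costs the sender $(\ell-1)f_0$, and each of its $\ell-1$ intermediate nodes receives $f_0$. If the cheapest route costs less than $F_B$, the transaction is executed along a cheapest (shortest) route; if there are several, one is chosen uniformly at random and costs and revenues are taken in expectation. Otherwise (no route of cost less than $F_B$) the transaction is executed on-chain and the sender pays $F_B$. The cost of node $u$ is $|\mu_u|F_B$, plus the fees $u$ pays as sender (off-chain routing fees, and $F_B$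 per on-chain transaction), minus the (expected) forwarding revenue of $u$. Each node wants to minimize its cost. A (pure) Nash equilibrium is a strategy combination in which no node can strictly decrease its cost by unilaterally changing its strategy. *)

theory Defs
  imports "HOL-Probability.Probability_Mass_Function" "HOL-Library.Multiset"
begin

text \<open>A strategy combination maps each node to the set of nodes to which it opens channels,
  a payment scenario is a multiset of (sender, receiver) pairs.\<close>

type_synonym 'a strategies = "'a \<Rightarrow> 'a set"
type_synonym 'a payments = "('a \<times> 'a) multiset"

definition valid_strategies :: "'a set \<Rightarrow> 'a strategies \<Rightarrow> bool" where
  "valid_strategies V \<mu> \<longleftrightarrow> (\<forall>u\<in>V. \<mu> u \<subseteq> V - {u})"

definition channel :: "'a strategies \<Rightarrow> 'a \<Rightarrow> 'a \<Rightarrow> bool" where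
  "channel \<mu> u v \<longleftrightarrow> v \<in> \<mu> u \<or> u \<in> \<mu> v"

definition routes :: "'a set \<Rightarrow> 'a strategies \<Rightarrow> 'a \<times> 'a \<Rightarrow> 'a list set" where
  "routes V \<mu> t = {p. p \<noteq> [] \<and> hd p = fst t \<and> last p = snd t \<and>
     set p \<subseteq> V \<and> distinct p \<and> successively (channel \<mu>) p}"

definition intermediate :: "'a list \<Rightarrow> 'a set" where
  "intermediate p = set (butlast (tl p))"

text \<open>A route is the list of its nodes, so one with \<open>l\<close> edges has length \<open>l + 1\<close>.
  The truncated subtraction is harmless, as sender and receiver of a payment differ.\<close>

definition route_cost :: "real \<Rightarrow> 'a list \<Rightarrow> real" where
  "route_cost f0 p = real (length p - 2) * f0"

text \<open>For \<open>f0 > 0\<close> these are exactly the shortest routes; for \<open>f0 = 0\<close> all routes are equally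
  cheap, and the choice among them affects neither fees nor revenues.\<close>

definition cheapest_routes :: "'a set \<Rightarrow> real \<Rightarrow> 'a strategies \<Rightarrow> 'a \<times> 'a \<Rightarrow> 'a list set" where
  "cheapest_routes V f0 \<mu> t =
     {p \<in> routes V \<mu> t. \<forall>q \<in> routes V \<mu> t. route_cost f0 p \<le> route_cost f0 q}"

definition off_chain :: "'a set \<Rightarrow> real \<Rightarrow> real \<Rightarrow> 'a strategies \<Rightarrow> 'a \<times> 'a \<Rightarrow> bool" where
  "off_chain V FB f0 \<mu> t \<longleftrightarrow> (\<exists>p \<in> cheapest_routes V f0 \<mu> t. route_cost f0 p < FB)"

definition sender_fee :: "'a set \<Rightarrow> real \<Rightarrow> real \<Rightarrow> 'a strategies \<Rightarrow> 'a \<times> 'a \<Rightarrow> real" where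
  "sender_fee V FB f0 \<mu> t =
     (if off_chain V FB f0 \<mu> t
      then measure_pmf.expectation (pmf_of_set (cheapest_routes V f0 \<mu> t)) (route_cost f0)
      else FB)"

definition forwarding_revenue ::
    "'a set \<Rightarrow> real \<Rightarrow> real \<Rightarrow> 'a strategies \<Rightarrow> 'a \<Rightarrow> 'a \<times> 'a \<Rightarrow> real" where
  "forwarding_revenue V FB f0 \<mu> u t =
     (if off_chain V FB f0 \<mu> t
      then measure_pmf.expectation (pmf_of_set (cheapest_routes V f0 \<mu> t))
             (\<lambda>p. if u \<in> intermediate p then f0 else 0)
      else 0)"

definition node_cost ::
    "'a set \<Rightarrow> real \<Rightarrow> real \<Rightarrow> 'a payments \<Rightarrow> 'a strategies \<Rightarrow> 'a \<Rightarrow> real" where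
  "node_cost V FB f0 T \<mu> u =
     real (card (\<mu> u)) * FB
     + (\<Sum>t \<in># filter_mset (\<lambda>t. fst t = u) T. sender_fee V FB f0 \<mu> t)
     - (\<Sum>t \<in># T. forwarding_revenue V FB f0 \<mu> u t)"

definition nash_equilibrium ::
    "'a set \<Rightarrow> real \<Rightarrow> real \<Rightarrow> 'a payments \<Rightarrow> 'a strategies \<Rightarrow> bool" where
  "nash_equilibrium V FB f0 T \<mu> \<longleftrightarrow>
     valid_strategies V \<mu> \<and>
     (\<forall>u\<in>V. \<forall>S. S \<subseteq> V - {u} \<longrightarrow>
        \<not> node_cost V FB f0 T (\<mu>(u := S)) u < node_cost V FB f0 T \<mu> u)"

definition homogeneous_payments :: "'a set \<Rightarrow> nat \<Rightarrow> 'a payments" where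
  "homogeneous_payments V k =
     repeat_mset k (mset_set {(s, r). s \<in> V \<and> r \<in> V \<and> s \<noteq> r})"

definition two_center_star :: "'a set \<Rightarrow> 'a \<Rightarrow> 'a \<Rightarrow> 'a strategies" where
  "two_center_star V a b u = (if u = a \<or> u = b then V - {a, b} else {})"

end

theory Submission
  imports Defs
begin

text \<open>Every unilateral deviation leaves at least one center connected to all outer nodes, so
  payments not involving the deviator travel at most two hops.  With \<open>x = k f0\<close>, \<open>M = N - 2\<close> outer
  nodes, an outer node that opens \<open>s\<close> channels to outer nodes saves \<open>s x\<close> in fees and, as one of
  three relays, earns \<open>s (s - 1) x / 3\<close>; since \<open>s \<le> M - 1\<close>, the upper bound on \<open>f0\<close> makes this
  less than the price \<open>s FB\<close>.  A center that drops \<open>d\<close> of its \<open>M\<close> channels and keeps \<open>m = M - d\<close>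
  loses \<open>d (M + m - 1) x / 2\<close> in revenue on top of higher fees, which by the lower bound on \<open>f0\<close>
  outweighs the \<open>d FB\<close> saved.  The critical deviation is the one with \<open>m = 0\<close> and a channel to the
  other center: there the comparison becomes an equality at \<open>f0 = 2 FB / (k N)\<close>.\<close>

section \<open>Counting ordered pairs of distinct nodes\<close>

abbreviation ordered_pairs :: "'a set \<Rightarrow> ('a \<times> 'a) set" where
  "ordered_pairs A \<equiv> {(s, r). s \<in> A \<and> r \<in> A \<and> s \<noteq> r}"

lemma ordered_pairs_eq: "ordered_pairs A = A \<times> A - (\<lambda>x. (x, x)) ` A"
  by auto

lemma finite_ordered_pairs: "finite A \<Longrightarrow> finite (ordered_pairs A)"
  unfolding ordered_pairs_eq by simp

lemma card_ordered_pairs: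
  assumes "finite A"
  shows "real (card (ordered_pairs A)) = real (card A) * (real (card A) - 1)"
proof -
  have "card (ordered_pairs A) = card A * card A - card A"
    unfolding ordered_pairs_eq
    by (subst card_Diff_subset) (use assms in \<open>auto simp: card_image inj_on_def card_cartesian_product\<close>)
  moreover have "card A \<le> card A * card A"
    by simp
  ultimately show ?thesis
    by (simp add: of_nat_diff algebra_simps)
qed

subsection \<open>Routes, fees and revenues\<close>

text \<open>Midpoints of two-hop routes. Together with the channel relation this set settles every
  revenue below, since payments between two non-deviating nodes never need a third hop.\<close>

definition relays :: "'a set \<Rightarrow> 'a strategies \<Rightarrow> 'a \<Rightarrow> 'a \<Rightarrow> 'a set" where
  "relays V \<mu> s r = {w \<in> V - {s, r}. channel \<mu> s w \<and> channel \<mu> w r}"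

lemma finite_relays: "finite V \<Longrightarrow> finite (relays V \<mu> s r)"
  by (simp add: relays_def)

lemma finite_cheapest_routes:
  assumes "finite V"
  shows "finite (cheapest_routes V f0 \<mu> t)"
  by (rule finite_subset[OF _ finite_subset_distinct[OF assms]])
    (auto simp: cheapest_routes_def routes_def)

text \<open>Routes with at least three edges need no finer description: their cost is at least
  \<open>2 * f0\<close>, which already rules them out as cheapest whenever a shorter route
  exists.\<close>

lemma route_cases:
  assumes "p \<in> routes V \<mu> (s, r)" and "s \<noteq> r"
  obtains (direct) "p = [s, r]" "channel \<mu> s r"
  | (relay) w where "p = [s, w, r]" "w \<in> relays V \<mu> s r"
  | (long) "length p \<ge> 4"
proof -
  from assms consider "p = [s, r]" "channel \<mu> s r"
    | w where "p = [s, w, r]" "w \<in> relays V \<mu> s r" | "length p \<ge> 4"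
    by (cases p rule: list.exhaust[case_product list.exhaust];
        auto simp: routes_def relays_def neq_Nil_conv Suc_le_eq split: if_splits)
  thus thesis using that by metis
qed

text \<open>Positivity of \<open>f0\<close> is essential: every other route has an intermediate node
  and so costs strictly more, whereas for \<open>f0 = 0\<close> all routes would tie.\<close>

lemma cheapest_routes_direct:
  assumes "f0 > 0" "s \<in> V" "r \<in> V" "s \<noteq> r" "channel \<mu> s r"
  shows "cheapest_routes V f0 \<mu> (s, r) = {[s, r]}"
proof -
  have route: "[s, r] \<in> routes V \<mu> (s, r)"
    using assms by (simp add: routes_def)
  have "p = [s, r]" if p: "p \<in> cheapest_routes V f0 \<mu> (s, r)" for p
  proof -
    from p route have p: "p \<in> routes V \<mu> (s, r)" "route_cost f0 p \<le> route_cost f0 [s, r]"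
      by (auto simp: cheapest_routes_def)
    from p(1) \<open>s \<noteq> r\<close> show ?thesis
      using p(2) \<open>f0 > 0\<close>
      by (cases rule: route_cases) (auto simp: route_cost_def mult_le_0_iff)
  qed
  moreover have "[s, r] \<in> cheapest_routes V f0 \<mu> (s, r)"
    using route \<open>f0 > 0\<close> by (auto simp: cheapest_routes_def route_cost_def)
  ultimately show ?thesis by blast
qed

lemma cheapest_routes_relay:
  assumes "f0 > 0" "s \<in> V" "r \<in> V" "s \<noteq> r" "\<not> channel \<mu> s r" "relays V \<mu> s r \<noteq> {}"
  shows "cheapest_routes V f0 \<mu> (s, r) = (\<lambda>w. [s, w, r]) ` relays V \<mu> s r"
proof -
  have route: "[s, w, r] \<in> routes V \<mu> (s, r)" if "w \<in> relays V \<mu> s r" for w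
    using that assms by (auto simp: routes_def relays_def)
  have "p \<in> (\<lambda>w. [s, w, r]) ` relays V \<mu> s r"
    if p: "p \<in> cheapest_routes V f0 \<mu> (s, r)" for p
  proof -
    obtain w where "w \<in> relays V \<mu> s r"
      using assms(6) by blast
    with p route have p: "p \<in> routes V \<mu> (s, r)" "route_cost f0 p \<le> route_cost f0 [s, w, r]"
      by (auto simp: cheapest_routes_def)
    from p(1) \<open>s \<noteq> r\<close> show ?thesis
      using p(2) assms by (cases rule: route_cases) (auto simp: route_cost_def)
  qed
  moreover have "[s, w, r] \<in> cheapest_routes V f0 \<mu> (s, r)" if w: "w \<in> relays V \<mu> s r" for w
  proof -
    have "route_cost f0 [s, w, r] \<le> route_cost f0 q" if "q \<in> routes V \<mu> (s, r)" for q
      using that \<open>s \<noteq> r\<close> assms by (cases rule: route_cases) (auto simp: route_cost_def)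
    thus ?thesis
      using route[OF w] by (simp add: cheapest_routes_def)
  qed
  ultimately show ?thesis by blast
qed

lemma
  assumes "f0 > 0" "FB > 0" "s \<in> V" "r \<in> V" "s \<noteq> r" "channel \<mu> s r"
  shows sender_fee_direct: "sender_fee V FB f0 \<mu> (s, r) = 0"
    and forwarding_revenue_direct: "forwarding_revenue V FB f0 \<mu> u (s, r) = 0"
  using cheapest_routes_direct[of f0 s V r \<mu>] assms
  by (simp_all add: sender_fee_def forwarding_revenue_def off_chain_def route_cost_def
      intermediate_def integral_pmf_of_set)

text \<open>The map from a relay to its route is injective, so a uniformly random cheapest route
  means a uniformly random relay, and each relay earns an equal share of \<open>f0\<close>. The
  bound \<open>f0 < FB\<close> keeps the payment off-chain.\<close>

lemma
  assumes "finite V" "f0 > 0" "f0 < FB" "s \<in> V" "r \<in> V" "s \<noteq> r" "\<not> channel \<mu> s r"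
    and "relays V \<mu> s r \<noteq> {}"
  shows sender_fee_relay: "sender_fee V FB f0 \<mu> (s, r) = f0"
    and forwarding_revenue_relay: "forwarding_revenue V FB f0 \<mu> u (s, r) =
      (if u \<in> relays V \<mu> s r then f0 / real (card (relays V \<mu> s r)) else 0)"
proof -
  let ?R = "relays V \<mu> s r"
  have inj: "inj_on (\<lambda>w. [s, w, r]) ?R"
    by (simp add: inj_on_def)
  have cheapest: "cheapest_routes V f0 \<mu> (s, r) = (\<lambda>w. [s, w, r]) ` ?R"
    using assms by (intro cheapest_routes_relay)
  have off: "off_chain V FB f0 \<mu> (s, r)"
    using assms(3,8) by (auto simp: off_chain_def cheapest route_cost_def)
  have avg: "measure_pmf.expectation (pmf_of_set (cheapest_routes V f0 \<mu> (s, r))) g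
      = (\<Sum>w\<in>?R. g [s, w, r]) / real (card ?R)" for g :: "'a list \<Rightarrow> real"
    using finite_relays[OF \<open>finite V\<close>, of \<mu> s r] assms(8)
    by (simp add: cheapest integral_pmf_of_set card_image[OF inj] sum.reindex[OF inj])
  have "card ?R > 0"
    using finite_relays[OF \<open>finite V\<close>] assms(8) by (simp add: card_gt_0_iff)
  thus "sender_fee V FB f0 \<mu> (s, r) = f0"
    by (simp add: sender_fee_def off avg route_cost_def)
  show "forwarding_revenue V FB f0 \<mu> u (s, r) =
      (if u \<in> ?R then f0 / real (card ?R) else 0)"
    using finite_relays[OF \<open>finite V\<close>, of \<mu> s r]
    by (simp add: forwarding_revenue_def off avg intermediate_def)
qed

text \<open>A lower bound is enough, because it serves only to show that a center loses by dropping
  channels. The minimum covers a route of at least three edges as well as on-chain payment,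
  including the case of no route.\<close>

lemma sender_fee_far:
  assumes "finite V" "f0 > 0" "s \<noteq> r" "\<not> channel \<mu> s r" "relays V \<mu> s r = {}"
  shows "min (2 * f0) FB \<le> sender_fee V FB f0 \<mu> (s, r)"
proof (cases "off_chain V FB f0 \<mu> (s, r)")
  case True
  let ?C = "cheapest_routes V f0 \<mu> (s, r)"
  from True have ne: "?C \<noteq> {}"
    by (auto simp: off_chain_def)
  note fin = finite_cheapest_routes[OF assms(1), of f0 \<mu> "(s, r)"]
  have "2 * f0 \<le> route_cost f0 p" if "p \<in> ?C" for p
  proof -
    from that have "p \<in> routes V \<mu> (s, r)"
      by (simp add: cheapest_routes_def)
    from this \<open>s \<noteq> r\<close> show ?thesis
      using assms by (cases rule: route_cases) (auto simp: route_cost_def)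
  qed
  hence "real (card ?C) * (2 * f0) \<le> sum (route_cost f0) ?C"
    by (rule sum_bounded_below)
  moreover have "card ?C > 0"
    using ne fin by (simp add: card_gt_0_iff)
  ultimately have "2 * f0 \<le> sum (route_cost f0) ?C / real (card ?C)"
    by (simp add: field_simps)
  thus ?thesis
    using True by (simp add: sender_fee_def integral_pmf_of_set[OF ne fin])
qed (simp add: sender_fee_def)

text \<open>A route between distinct nodes needs a first edge, so there is no route and the payment
  goes on-chain. This covers a center that closes all its channels and has none opened towards
  it.\<close>

lemma sender_fee_isolated:
  assumes "s \<noteq> r" "\<And>v. \<not> channel \<mu> s v"
  shows "sender_fee V FB f0 \<mu> (s, r) = FB"
proof -
  have "p \<notin> routes V \<mu> (s, r)" for p
    using assms by (cases p rule: list.exhaust[case_product list.exhaust])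
      (auto simp: routes_def successively_Cons split: if_splits)
  thus ?thesis
    by (auto simp: sender_fee_def off_chain_def cheapest_routes_def)
qed

lemma forwarding_revenue_endpoint:
  assumes "finite V" "s \<noteq> r" "u = s \<or> u = r"
  shows "forwarding_revenue V FB f0 \<mu> u (s, r) = 0"
proof (cases "off_chain V FB f0 \<mu> (s, r)")
  case True
  let ?C = "cheapest_routes V f0 \<mu> (s, r)"
  from True have ne: "?C \<noteq> {}"
    by (auto simp: off_chain_def)
  have "u \<notin> intermediate p" if "p \<in> ?C" for p
  proof -
    from that have "p \<noteq> []" "hd p = s" "last p = r" "distinct p"
      by (auto simp: cheapest_routes_def routes_def)
    then obtain q where q: "p = s # q"
      by (cases p) auto
    with \<open>last p = r\<close> \<open>s \<noteq> r\<close> have "q \<noteq> []" "last q = r"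
      by (auto split: if_splits)
    hence "q = butlast q @ [r]"
      \<comment> \<open>With \<open>p\<close> written as \<open>s # butlast q @ [r]\<close>, the
        intermediate nodes are those of \<open>butlast q\<close>, and distinctness separates them
        from both endpoints.\<close>
      by (metis append_butlast_last_id)
    with \<open>distinct p\<close> q have "distinct (s # butlast q @ [r])"
      by metis
    thus ?thesis
      using assms(3) q by (auto simp: intermediate_def)
  qed
  hence "(\<Sum>p\<in>?C. if u \<in> intermediate p then f0 else 0) = 0"
    by (intro sum.neutral) simp
  thus ?thesis
    by (simp add: forwarding_revenue_def
        integral_pmf_of_set[OF ne finite_cheapest_routes[OF assms(1)]])
qed (simp add: forwarding_revenue_def)

section \<open>Node cost under homogeneous payments\<close>

lemma sum_repeat_mset:
  fixes f :: "'b \<Rightarrow> real"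
  shows "(\<Sum>t\<in>#repeat_mset k M. f t) = real k * (\<Sum>t\<in>#M. f t)"
  by (induction k) (simp_all add: algebra_simps)

lemma filter_repeat_mset: "filter_mset P (repeat_mset k M) = repeat_mset k (filter_mset P M)"
  by (induction k) simp_all

lemma node_cost_homogeneous:
  assumes "finite V" "u \<in> V"
  shows "node_cost V FB f0 (homogeneous_payments V k) \<mu> u =
    real (card (\<mu> u)) * FB + real k * (\<Sum>r\<in>V - {u}. sender_fee V FB f0 \<mu> (u, r))
    - real k * (\<Sum>t\<in>ordered_pairs (V - {u}). forwarding_revenue V FB f0 \<mu> u t)"
proof -
  have "{t \<in> ordered_pairs V. fst t = u} = Pair u ` (V - {u})"
    using assms by auto
  hence "(\<Sum>t\<in>#filter_mset (\<lambda>t. fst t = u) (homogeneous_payments V k). sender_fee V FB f0 \<mu> t)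
    = real k * (\<Sum>t\<in>Pair u ` (V - {u}). sender_fee V FB f0 \<mu> t)"
    using finite_ordered_pairs[OF assms(1)]
    by (simp add: homogeneous_payments_def filter_repeat_mset sum_repeat_mset
        sum_unfold_sum_mset)
  also have "(\<Sum>t\<in>Pair u ` (V - {u}). sender_fee V FB f0 \<mu> t)
      = (\<Sum>r\<in>V - {u}. sender_fee V FB f0 \<mu> (u, r))"
    by (subst sum.reindex) (auto simp: inj_on_def)
  finally have fees: "(\<Sum>t\<in>#filter_mset (\<lambda>t. fst t = u) (homogeneous_payments V k).
      sender_fee V FB f0 \<mu> t) = real k * (\<Sum>r\<in>V - {u}. sender_fee V FB f0 \<mu> (u, r))" .
  have "(\<Sum>t\<in>#homogeneous_payments V k. forwarding_revenue V FB f0 \<mu> u t)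
    = real k * (\<Sum>t\<in>ordered_pairs V. forwarding_revenue V FB f0 \<mu> u t)"
    by (simp add: homogeneous_payments_def sum_repeat_mset sum_unfold_sum_mset)
  also have "(\<Sum>t\<in>ordered_pairs V. forwarding_revenue V FB f0 \<mu> u t)
      = (\<Sum>t\<in>ordered_pairs (V - {u}). forwarding_revenue V FB f0 \<mu> u t)"
    by (rule sum.mono_neutral_right)
      (use finite_ordered_pairs[OF assms(1)] in \<open>auto intro!: forwarding_revenue_endpoint assms(1)\<close>)
  finally show ?thesis
    by (simp add: node_cost_def fees)
qed

subsection \<open>Deviations from the star with two centers\<close>

text \<open>This symmetry lets the analysis treat only deviations of \<open>a\<close>; those of
  \<open>b\<close> follow by exchanging the centers.\<close>

lemma two_center_star_commute: "two_center_star V a b = two_center_star V b a"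
  by (auto simp: two_center_star_def fun_eq_iff)

lemma sum_ordered_pairs_subset:
  fixes c :: real
  assumes "finite A" "B \<subseteq> A"
  shows "(\<Sum>(s, r)\<in>ordered_pairs A. if s \<in> B \<and> r \<in> B then c else 0)
    = c * (real (card B) * (real (card B) - 1))"
proof -
  have "(\<Sum>(s, r)\<in>ordered_pairs A. if s \<in> B \<and> r \<in> B then c else 0)
      = (\<Sum>t\<in>ordered_pairs A. if t \<in> ordered_pairs B then c else 0)"
    by (rule sum.cong) (auto simp: case_prod_beta)
  also have "\<dots> = (\<Sum>t\<in>ordered_pairs A \<inter> ordered_pairs B. c)"
    by (rule sum.inter_restrict[symmetric]) (rule finite_ordered_pairs[OF assms(1)])
  also have "ordered_pairs A \<inter> ordered_pairs B = ordered_pairs B"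
    using assms(2) by auto
  finally show ?thesis
    using card_ordered_pairs[OF finite_subset[OF assms(2,1)]] by simp
qed

context
  fixes V :: "'a set" and a b :: 'a and k :: nat and FB f0 :: real and Out :: "'a set"
  assumes finV: "finite V" and f0: "0 < f0" "f0 < FB"
    and ab: "a \<in> V" "b \<in> V" "a \<noteq> b"
    and Out: "Out = V - {a, b}" and Out_ne: "Out \<noteq> {}"
begin

section \<open>Exact costs after a deviation\<close>

lemma finOut: "finite Out"
  using finV Out by simp

text \<open>The other center \<open>b\<close> still reaches every outer node, so \<open>a\<close>
  earns only on pairs of outer nodes that both lie in \<open>S\<close>, sharing each such fee
  equally with \<open>b\<close>. The fees that \<open>a\<close> pays stay unevaluated because they
  depend on whether \<open>S\<close> is empty or contains \<open>b\<close>.\<close>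

lemma center_cost:
  assumes S: "S \<subseteq> V - {a}"
  defines "\<mu> \<equiv> (two_center_star V a b)(a := S)"
  shows "node_cost V FB f0 (homogeneous_payments V k) \<mu> a =
    real (card S) * FB
    + real k * (sender_fee V FB f0 \<mu> (a, b)
                + (\<Sum>r\<in>Out - S. sender_fee V FB f0 \<mu> (a, r)))
    - real k * (f0 / 2 * (real (card (S \<inter> Out)) * (real (card (S \<inter> Out)) - 1)))"
proof -
  have ch: "channel \<mu> x y \<longleftrightarrow> (x = a \<and> y \<in> S) \<or> (y = a \<and> x \<in> S)
      \<or> (x = b \<and> y \<in> Out) \<or> (y = b \<and> x \<in> Out)" for x y
    using ab Out by (auto simp: channel_def \<mu>_def two_center_star_def)
  have "(\<Sum>r\<in>V - {a}. sender_fee V FB f0 \<mu> (a, r))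
      = sender_fee V FB f0 \<mu> (a, b) + (\<Sum>r\<in>Out. sender_fee V FB f0 \<mu> (a, r))"
  proof -
    have "V - {a} = insert b Out" "b \<notin> Out"
      using ab Out by auto
    thus ?thesis using finOut by simp
  qed
  also have "(\<Sum>r\<in>Out. sender_fee V FB f0 \<mu> (a, r)) = (\<Sum>r\<in>Out - S. sender_fee V FB f0 \<mu> (a, r))"
    by (rule sum.mono_neutral_right)
      (use finOut f0 ab Out in \<open>auto intro!: sender_fee_direct simp: ch\<close>)
  finally have fees: "(\<Sum>r\<in>V - {a}. sender_fee V FB f0 \<mu> (a, r))
      = sender_fee V FB f0 \<mu> (a, b) + (\<Sum>r\<in>Out - S. sender_fee V FB f0 \<mu> (a, r))" .
  have rev: "forwarding_revenue V FB f0 \<mu> a (s, r)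
      = (if s \<in> S \<inter> Out \<and> r \<in> S \<inter> Out then f0 / 2 else 0)"
    if "s \<in> V - {a}" "r \<in> V - {a}" "s \<noteq> r" for s r
  proof (cases "s = b \<or> r = b")
    case True
    with that ab Out have "channel \<mu> s r"
      by (auto simp: ch)
    with True that f0 Out show ?thesis
      by (auto simp: forwarding_revenue_direct)
  next
    case False
    with that Out have out: "s \<in> Out" "r \<in> Out"
      by auto
    with Out have nch: "\<not> channel \<mu> s r"
      by (auto simp: ch)
    have "relays V \<mu> s r = (if s \<in> S \<and> r \<in> S then {a, b} else {b})"
      using out ab Out by (auto simp: relays_def ch)
    thus ?thesis
      using forwarding_revenue_relay[OF finV f0 _ _ \<open>s \<noteq> r\<close> nch, of a] that ab out by auto
  qed
  have "(\<Sum>t\<in>ordered_pairs (V - {a}). forwarding_revenue V FB f0 \<mu> a t)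
      = (\<Sum>(s, r)\<in>ordered_pairs (V - {a}). if s \<in> S \<inter> Out \<and> r \<in> S \<inter> Out then f0 / 2 else 0)"
    by (rule sum.cong) (use rev in auto)
  also have "\<dots> = f0 / 2 * (real (card (S \<inter> Out)) * (real (card (S \<inter> Out)) - 1))"
    by (rule sum_ordered_pairs_subset) (use finV Out in auto)
  finally show ?thesis
    by (simp add: node_cost_homogeneous[OF finV ab(1)] fees) (simp add: \<mu>_def)
qed

lemma center_cost_star:
  "node_cost V FB f0 (homogeneous_payments V k) (two_center_star V a b) a =
    real (card Out) * FB + real k * f0
    - real k * (f0 / 2 * (real (card Out) * (real (card Out) - 1)))"
proof -
  let ?\<mu> = "two_center_star V a b"
  \<comment> \<open>The star is itself the deviation with \<open>S = Out\<close>, so the general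
    cost formula applies.\<close>
  have upd: "?\<mu>(a := Out) = ?\<mu>"
    by (rule fun_upd_idem) (simp add: Out two_center_star_def)
  have "channel ?\<mu> x y \<longleftrightarrow> (x \<in> {a, b} \<and> y \<in> Out) \<or> (y \<in> {a, b} \<and> x \<in> Out)" for x y
    using ab Out by (auto simp: channel_def two_center_star_def)
  hence "\<not> channel ?\<mu> a b" "relays V ?\<mu> a b = Out"
    using ab Out by (auto simp: relays_def)
  hence "sender_fee V FB f0 ?\<mu> (a, b) = f0"
    using finV f0 ab Out_ne by (intro sender_fee_relay) auto
  thus ?thesis
    using center_cost[of Out, unfolded upd] unfolding Out by auto
qed

text \<open>Both centers already have channels to \<open>u\<close>, so a channel from
  \<open>u\<close> to a center only costs money. The two payments between the centers (per unit of
  \<open>k\<close>) are shared by all outer nodes; a pair of outer nodes in \<open>S\<close> has the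
  three relays \<open>u\<close>, \<open>a\<close> and \<open>b\<close>.\<close>

lemma outer_cost:
  assumes u: "u \<in> Out" and S: "S \<subseteq> V - {u}"
  shows "node_cost V FB f0 (homogeneous_payments V k) ((two_center_star V a b)(u := S)) u =
    real (card S) * FB + real k * (real (card (Out - {u} - S)) * f0)
    - real k * (2 * f0 / real (card Out)
        + f0 / 3 * (real (card (S \<inter> Out)) * (real (card (S \<inter> Out)) - 1)))"
proof -
  define \<mu> where "\<mu> = (two_center_star V a b)(u := S)"
  have uab: "u \<in> V" "u \<noteq> a" "u \<noteq> b" "u \<notin> S"
    using u S Out by auto
  have ch: "channel \<mu> x y \<longleftrightarrow> (x = u \<and> y \<in> S) \<or> (y = u \<and> x \<in> S)
      \<or> (x \<in> {a, b} \<and> y \<in> Out) \<or> (y \<in> {a, b} \<and> x \<in> Out)" for x y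
    using ab Out uab by (auto simp: channel_def \<mu>_def two_center_star_def)
  have "(\<Sum>r\<in>V - {u}. sender_fee V FB f0 \<mu> (u, r))
      = (\<Sum>r\<in>Out - {u} - S. sender_fee V FB f0 \<mu> (u, r))"
    by (rule sum.mono_neutral_right)
      (use finV f0 u uab Out in \<open>auto intro!: sender_fee_direct simp: ch\<close>)
  also have "\<dots> = (\<Sum>r\<in>Out - {u} - S. f0)"
  proof (rule sum.cong)
    fix r assume r: "r \<in> Out - {u} - S"
    hence "\<not> channel \<mu> u r" "a \<in> relays V \<mu> u r"
      using u uab ab Out by (auto simp: ch relays_def)
    thus "sender_fee V FB f0 \<mu> (u, r) = f0"
      using r uab finV f0 Out by (intro sender_fee_relay) auto
  qed simp
  finally have fees: "(\<Sum>r\<in>V - {u}. sender_fee V FB f0 \<mu> (u, r))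
      = real (card (Out - {u} - S)) * f0"
    by simp
  \<comment> \<open>At most one summand is nonzero, as \<open>Out\<close> avoids the centers. The
    additive form lets \<open>sum_ordered_pairs_subset\<close> be applied to each summand.\<close>
  have rev: "forwarding_revenue V FB f0 \<mu> u (s, r)
      = (if s \<in> {a, b} \<and> r \<in> {a, b} then f0 / real (card Out) else 0)
      + (if s \<in> S \<inter> Out \<and> r \<in> S \<inter> Out then f0 / 3 else 0)"
    if sr: "s \<in> V - {u}" "r \<in> V - {u}" "s \<noteq> r" for s r
  proof -
    consider (centers) "s \<in> {a, b}" "r \<in> {a, b}" | (outer) "s \<in> Out" "r \<in> Out"
      | (mixed) "s \<in> {a, b} \<and> r \<in> Out \<or> s \<in> Out \<and> r \<in> {a, b}"
      using sr Out by blast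
    thus ?thesis
    proof cases
      case centers
      hence "\<not> channel \<mu> s r" "relays V \<mu> s r = Out"
        using that ab Out uab by (auto simp: ch relays_def)
      thus ?thesis
        using forwarding_revenue_relay[OF finV f0 _ _ \<open>s \<noteq> r\<close>, of \<mu> u] that centers u Out by auto
    next
      case outer
      hence "\<not> channel \<mu> s r"
        using that Out by (auto simp: ch)
      moreover have "relays V \<mu> s r = (if s \<in> S \<and> r \<in> S then {u, a, b} else {a, b})"
        using outer that ab Out uab by (auto simp: relays_def ch)
      ultimately show ?thesis
        using forwarding_revenue_relay[OF finV f0 _ _ \<open>s \<noteq> r\<close>, of \<mu> u] that ab outer uab Out
        by auto
    next
      case mixed
      hence "channel \<mu> s r"
        by (auto simp: ch)
      thus ?thesis
        using mixed that f0 Out by (auto simp: forwarding_revenue_direct)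
    qed
  qed
  have "(\<Sum>t\<in>ordered_pairs (V - {u}). forwarding_revenue V FB f0 \<mu> u t)
      = (\<Sum>t\<in>ordered_pairs (V - {u}).
          (case t of (s, r) \<Rightarrow> if s \<in> {a, b} \<and> r \<in> {a, b} then f0 / real (card Out) else 0)
        + (case t of (s, r) \<Rightarrow> if s \<in> S \<inter> Out \<and> r \<in> S \<inter> Out then f0 / 3 else 0))"
    by (rule sum.cong) (use rev in auto)
  also have "\<dots> = f0 / real (card Out) * (real (card {a, b}) * (real (card {a, b}) - 1))
      + f0 / 3 * (real (card (S \<inter> Out)) * (real (card (S \<inter> Out)) - 1))"
    unfolding sum.distrib
    by (intro arg_cong2[where f = "(+)"] sum_ordered_pairs_subset)
      (use finV ab uab Out in auto)
  also have "f0 / real (card Out) * (real (card {a, b}) * (real (card {a, b}) - 1))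
      = 2 * f0 / real (card Out)"
    using ab by simp
  finally show ?thesis
    unfolding \<mu>_def[symmetric]
    by (simp add: node_cost_homogeneous[OF finV uab(1)] fees) (simp add: \<mu>_def)
qed

section \<open>No deviation is profitable\<close>

lemma center_optimal:
  assumes k: "k \<ge> 1" and card_Out: "card Out \<ge> 2"
    and lower: "2 * FB \<le> real k * f0 * (real (card Out) + 2)"
    and upper: "real k * f0 * (real (card Out) + 1) \<le> 3 * FB"
    and S: "S \<subseteq> V - {a}"
  shows "node_cost V FB f0 (homogeneous_payments V k) (two_center_star V a b) a
    \<le> node_cost V FB f0 (homogeneous_payments V k) ((two_center_star V a b)(a := S)) a"
proof -
  define \<mu> where "\<mu> = (two_center_star V a b)(a := S)"
  define M where "M = real (card Out)"
  define m where "m = real (card (S \<inter> Out))"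
  define d where "d = real (card (Out - S))"
  define x where "x = real k * f0"
  have ch: "channel \<mu> x y \<longleftrightarrow> (x = a \<and> y \<in> S) \<or> (y = a \<and> x \<in> S)
      \<or> (x = b \<and> y \<in> Out) \<or> (y = b \<and> x \<in> Out)" for x y
    using ab Out by (auto simp: channel_def \<mu>_def two_center_star_def)
  have M: "M = m + d"
    using card_Int_Diff[OF finOut, of S] by (simp add: M_def m_def d_def Int_commute)
  have d: "d \<ge> 0"
    by (simp add: d_def)
  have x: "x > 0" "real k * FB \<ge> FB"
    using k f0 by (auto simp: x_def)
  have M2: "M \<ge> 2" and lower: "2 * FB \<le> x * (M + 2)" and upper: "x * (M + 1) \<le> 3 * FB"
    using card_Out lower upper by (simp_all add: M_def x_def)
  \<comment> \<open>The upper bound on \<open>f0\<close> enters here: with \<open>M\<close> at least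
    2 it yields \<open>3 * x \<le> 3 * FB\<close>.\<close>
  have x_le: "x \<le> FB"
  proof -
    have "x * 3 \<le> x * (M + 1)"
      using x M2 by (intro mult_left_mono) auto
    thus ?thesis using upper by simp
  qed
  define F where "F = sender_fee V FB f0 \<mu> (a, b) + (\<Sum>r\<in>Out - S. sender_fee V FB f0 \<mu> (a, r))"
  have "M * FB + x - x * (M * (M - 1)) / 2
      \<le> real (card S) * FB + real k * F - x * (m * (m - 1)) / 2"
  proof -
    consider (none) "S = {}" | (without) "S \<noteq> {}" "b \<notin> S" | (with_b) "b \<in> S"
      by blast
    thus ?thesis
    proof cases
      case none
      have iso: "sender_fee V FB f0 \<mu> (a, r) = FB" if "r \<noteq> a" for r
        using that none ab Out by (intro sender_fee_isolated) (auto simp: ch)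
      \<comment> \<open>All \<open>M + 1\<close> receivers are paid on-chain. Since
        \<open>x \<le> FB\<close>, this alone outweighs the star's channel costs and its fee
        \<open>x\<close>, even before its revenue is counted.\<close>
      have "F = (M + 1) * FB"
      proof -
        have "(\<Sum>r\<in>Out - S. sender_fee V FB f0 \<mu> (a, r)) = (\<Sum>r\<in>Out - S. FB)"
          using Out by (intro sum.cong iso) auto
        thus ?thesis
          using iso[of b] ab none by (simp add: F_def M_def algebra_simps)
      qed
      moreover have "(M + 1) * FB \<le> (M + 1) * (real k * FB)"
        using x M2 by (intro mult_left_mono) auto
      moreover have "0 \<le> x * (M * (M - 1))"
        using x M2 by simp
      ultimately show ?thesis
        using none x x_le by (simp add: m_def algebra_simps diff_divide_distrib)
    next
      case without
      have SO: "S \<inter> Out = S"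
        using S without Out by auto
      hence m: "m = real (card S)"
        by (simp add: m_def)
      have "m \<ge> 1"
        using without SO finOut by (simp add: m Suc_le_eq card_gt_0_iff) (metis finite_Int)
      have "relays V \<mu> a b = S" "\<not> channel \<mu> a b"
        using S without ab SO Out by (auto simp: relays_def ch)
      hence fee_b: "sender_fee V FB f0 \<mu> (a, b) = f0"
        using finV f0 ab without by (intro sender_fee_relay) auto
      have "min (2 * f0) FB \<le> sender_fee V FB f0 \<mu> (a, r)" if "r \<in> Out - S" for r
        using that without ab SO Out finV f0
        by (intro sender_fee_far) (auto simp: relays_def ch)
      hence "d * min (2 * f0) FB \<le> (\<Sum>r\<in>Out - S. sender_fee V FB f0 \<mu> (a, r))"
        unfolding d_def by (rule sum_bounded_below)
      hence F: "real k * (f0 + d * min (2 * f0) FB) \<le> real k * F"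
        by (intro mult_left_mono) (simp_all add: F_def fee_b)
      \<comment> \<open>This is the comparison per dropped channel: M(M-1) - m(m-1) = d(M+m-1), so
        each of the \<open>d\<close> dropped channels accounts for a revenue loss of
        \<open>x * (M + m - 1) / 2\<close>.\<close>
      have "FB \<le> real k * min (2 * f0) FB + x * (M + m - 1) / 2"
      proof (cases "2 * f0 \<le> FB")
        case True
        have "x * (M + 2) \<le> x * (M + m - 1 + 4)"
          using x \<open>m \<ge> 1\<close> by (intro mult_left_mono) auto
        thus ?thesis
          using True lower by (simp add: x_def algebra_simps add_divide_distrib diff_divide_distrib)
      next
        case False
        have "0 \<le> x * (M + m - 1)"
          using x \<open>m \<ge> 1\<close> M2 by simp
        thus ?thesis
          using False x by simp
      qed
      from mult_left_mono[OF this d] F show ?thesis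
        by (simp add: M m[symmetric] x_def algebra_simps add_divide_distrib diff_divide_distrib)
    next
      case with_b
      have "S = insert b (S \<inter> Out)" "b \<notin> S \<inter> Out"
        using S with_b Out by auto
      hence card_S: "real (card S) = m + 1"
        using finOut by (metis card_insert_disjoint finite_Int m_def of_nat_Suc add.commute)
      have fee_b: "sender_fee V FB f0 \<mu> (a, b) = 0"
        using f0 ab with_b by (intro sender_fee_direct) (auto simp: ch)
      have "sender_fee V FB f0 \<mu> (a, r) = f0" if "r \<in> Out - S" for r
      proof (rule sender_fee_relay)
        have "b \<in> relays V \<mu> a r"
          using that with_b ab Out by (auto simp: relays_def ch)
        thus "relays V \<mu> a r \<noteq> {}" by blast
      qed (use that with_b ab Out finV f0 in \<open>auto simp: ch\<close>)
      hence F: "real k * F = d * x"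
        by (simp add: F_def fee_b d_def x_def)
      \<comment> \<open>The right side is the deviation cost minus the star cost: the channel to
        \<open>b\<close> costs \<open>FB\<close> and saves the fee \<open>x\<close>, while each
        dropped channel saves \<open>FB\<close> but costs \<open>x\<close> in fees and
        \<open>x * (M + m - 1) / 2\<close> in revenue.\<close>
      have "0 \<le> FB - x + d * (x * (M + m + 1) / 2 - FB)"
      proof (cases "m \<ge> 1")
        case True
        have "x * (M + 2) \<le> x * (M + m + 1)"
          using x True by (intro mult_left_mono) auto
        with lower have "0 \<le> x * (M + m + 1) / 2 - FB"
          by simp
        from mult_nonneg_nonneg[OF d this] x_le show ?thesis
          by simp
      next
        case False
        hence m: "m = 0"
          by (simp add: m_def)
        \<comment> \<open>Here \<open>d = M\<close> and the bracket may be negative, so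
          \<open>FB - x\<close> must be included. The total factors as (M-1)(x(M+2)/2 - FB), because
          M(M+1) - 2 = (M-1)(M+2).\<close>
        have "2 * FB * (M - 1) \<le> x * (M + 2) * (M - 1)"
          using lower M2 by (intro mult_right_mono) auto
        thus ?thesis
          using M m by (simp add: field_simps)
      qed
      thus ?thesis
        unfolding F card_S M by (simp add: field_simps)
    qed
  qed
  thus ?thesis
    unfolding center_cost[OF S] center_cost_star
    by (simp add: F_def M_def m_def x_def \<mu>_def mult.assoc)
qed

lemma outer_optimal:
  assumes upper: "real k * f0 * (real (card Out) + 1) \<le> 3 * FB"
    and u: "u \<in> Out" and S: "S \<subseteq> V - {u}"
  shows "node_cost V FB f0 (homogeneous_payments V k) (two_center_star V a b) u
    \<le> node_cost V FB f0 (homogeneous_payments V k) ((two_center_star V a b)(u := S)) u"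
proof -
  define M where "M = real (card Out)"
  define s where "s = real (card (S \<inter> Out))"
  define x where "x = real k * f0"
  have "(two_center_star V a b)(u := {}) = two_center_star V a b"
    by (rule fun_upd_idem) (use u in \<open>simp add: Out two_center_star_def\<close>)
  hence base: "node_cost V FB f0 (homogeneous_payments V k) (two_center_star V a b) u
      = real k * (real (card (Out - {u})) * f0) - real k * (2 * f0 / M)"
    using outer_cost[OF u, of "{}"] by (simp add: M_def)
  have "card Out > 0"
    using u finOut by (auto simp: card_gt_0_iff)
  hence n: "real (card (Out - {u})) = M - 1"
    using u finOut by (simp add: M_def of_nat_diff Suc_le_eq)
  have "S \<inter> Out = (Out - {u}) \<inter> S"
    using S by auto
  hence diff: "real (card (Out - {u} - S)) = M - 1 - s"
    using card_Int_Diff[of "Out - {u}" S] finOut n by (simp add: s_def)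
  have "s \<le> real (card S)"
    unfolding s_def using finite_subset[OF S] finV by (simp add: card_mono)
  hence "s * FB \<le> real (card S) * FB"
    using f0 by (intro mult_right_mono) auto
  \<comment> \<open>Fee savings and new revenue add up to s x + s(s-1)x/3 = s(s+2)x/3. The bound
    \<open>s \<le> M - 1\<close> comes from \<open>diff\<close>, whose left side is a
    cardinality.\<close>
  moreover have "x * (s + 2) \<le> 3 * FB"
  proof -
    have "x * (s + 2) \<le> x * (M + 1)"
      using diff f0 by (intro mult_left_mono) (auto simp: x_def)
    thus ?thesis
      using upper by (simp add: x_def M_def)
  qed
  hence "s * (x * (s + 2)) \<le> s * (3 * FB)"
    by (intro mult_left_mono) (simp_all add: s_def)
  ultimately show ?thesis
    unfolding base outer_cost[OF u S] diff n M_def[symmetric] s_def[symmetric]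
    by (simp add: x_def field_simps)
qed

end

section \<open>Assembling the equilibrium\<close>

theorem mainTheorem3:
  fixes V :: "'a set" and a b :: 'a and N k :: nat and FB f0 :: real
  assumes "finite V" and "card V = N" and "N > 3"
    and "FB > 0" and "f0 \<ge> 0" and "k \<ge> 1"
    and "a \<in> V" and "b \<in> V" and "a \<noteq> b"
    and "FB / real k * (2 / real N) < f0"
    and "f0 < FB / real k * (3 / (real N - 1))"
  shows "nash_equilibrium V FB f0 (homogeneous_payments V k) (two_center_star V a b)"
proof -
  let ?T = "homogeneous_payments V k" and ?\<mu> = "two_center_star V a b"
  define Out where "Out = V - {a, b}"
  have "card Out = N - 2"
    unfolding Out_def using assms by (subst card_Diff_subset) auto
  hence card_Out: "real (card Out) = real N - 2" "card Out \<ge> 2"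
    using assms(3) by (simp_all add: of_nat_diff)
  hence Out_ne: "Out \<noteq> {}"
    by auto
  \<comment> \<open>Clearing denominators turns \<open>N\<close> into \<open>card Out + 2\<close>
    and \<open>N - 1\<close> into \<open>card Out + 1\<close>.\<close>
  have lower: "2 * FB \<le> real k * f0 * (real (card Out) + 2)"
    using assms(3,6,10) by (simp add: card_Out field_simps)
  have upper: "real k * f0 * (real (card Out) + 1) \<le> 3 * FB"
    using assms(3,6,11) by (simp add: card_Out field_simps)
  have f0_pos: "f0 > 0"
    by (rule le_less_trans[OF _ assms(10)]) (use assms(4) in simp)
  have f0_less: "f0 < FB"
  proof -
    \<comment> \<open>As \<open>k \<ge> 1\<close> and \<open>N > 3\<close>, the assumed upper bound
      on \<open>f0\<close> is at most \<open>FB\<close>, so two-hop routes beat on-chain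
      payment.\<close>
    have "1 * 3 \<le> real k * (real N - 1)"
      using assms(3,6) by (intro mult_mono) auto
    hence "FB * 3 \<le> FB * (real k * (real N - 1))"
      using assms(4) by (intro mult_left_mono) auto
    hence "FB / real k * (3 / (real N - 1)) \<le> FB"
      using assms(3,6) by (simp add: field_simps)
    thus ?thesis using assms(11) by simp
  qed
  have "node_cost V FB f0 ?T ?\<mu> u \<le> node_cost V FB f0 ?T (?\<mu>(u := S)) u"
    if u: "u \<in> V" and S: "S \<subseteq> V - {u}" for u S
  proof -
    consider "u = a" | "u = b" | "u \<in> Out"
      using u by (auto simp: Out_def)
    thus ?thesis
    proof cases
      case 1
      with S show ?thesis
        using center_optimal[OF assms(1) f0_pos f0_less assms(7-9) Out_def Out_ne assms(6)
            card_Out(2) lower upper] by blast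
    next
      case 2
      have "Out = V - {b, a}"
        by (auto simp: Out_def)
      with 2 S show ?thesis
        using center_optimal[OF assms(1) f0_pos f0_less assms(8,7) assms(9)[symmetric] _ Out_ne
            assms(6) card_Out(2) lower upper] two_center_star_commute[of V a b] by metis
    next
      case 3
      with S show ?thesis
        using outer_optimal[OF assms(1) f0_pos f0_less assms(7-9) Out_def Out_ne upper] by blast
    qed
  qed
  moreover have "valid_strategies V ?\<mu>"
    by (auto simp: valid_strategies_def two_center_star_def)
  ultimately show ?thesis
    by (auto simp: nash_equilibrium_def not_less)
qed

end
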